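(* Let $R$ be a commutative Noetherian ring. Then the following hold. (i) $R$ has only finitely many pure ideals, and they are exactly the ideals of the form $Re$ where $e$ is an idempotent of $R$. In particular, every purely-prime ideal of $R$ is purely-maximal. (ii) The purely-prime ideals of $R$ are exactly the ideals of the form $R(1-e)$ where $e$ is a primitive idempotent of $R$.
   Context: Rings are commutative with identity. An ideal $I$ of a ring $R$ is called a pure ideal if $R/I$ is a flat $R$-module, or equivalently, if for each $a\in I$ there exists some $b\in I$ such that $a(1-b)=0$. The zero ideal and $R$ itself are always pure. A purely-prime ideal of $R$ is a proper pure ideal $I$ of $R$ such that whenever $J$ and $J'$ are pure ideals of $R$ with $JJ'\subseteq I$, then $J\subseteq I$ or $J'\subseteq I$. A purely-maximal ideal of $R$ is a proper pure ideal of $R$ that is a maximal element (with respect to inclusion) of the set of proper pure ideals of $R$. A primitive idempotent of $R$ is a nonzero idempotent $e\in R$ such that if $ee'=e'$ for some nonzero idempotent $e'\in R$, then $e=e'$. *)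

theory Defs
  imports "HOL-Algebra.Ring_Divisibility" "HOL-Algebra.Ideal_Product"
begin

text \<open>Flatness of \<open>R/I\<close> over a commutative ring \<open>R\<close> is expressed by the usual elementwise
  condition: every \<open>a \<in> I\<close> is annihilated by \<open>1 - b\<close> for some \<open>b \<in> I\<close>.\<close>

definition pure_ideal :: "'a set \<Rightarrow> ('a, 'b) ring_scheme \<Rightarrow> bool"
  where "pure_ideal I R \<longleftrightarrow>
    ideal I R \<and> (\<forall>a\<in>I. \<exists>b\<in>I. a \<otimes>\<^bsub>R\<^esub> (\<one>\<^bsub>R\<^esub> \<ominus>\<^bsub>R\<^esub> b) = \<zero>\<^bsub>R\<^esub>)"

definition purely_prime_ideal :: "'a set \<Rightarrow> ('a, 'b) ring_scheme \<Rightarrow> bool"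
  where "purely_prime_ideal I R \<longleftrightarrow>
    pure_ideal I R \<and> I \<noteq> carrier R \<and>
    (\<forall>J J'. pure_ideal J R \<longrightarrow> pure_ideal J' R \<longrightarrow> ideal_prod R J J' \<subseteq> I \<longrightarrow> J \<subseteq> I \<or> J' \<subseteq> I)"

definition purely_maximal_ideal :: "'a set \<Rightarrow> ('a, 'b) ring_scheme \<Rightarrow> bool"
  where "purely_maximal_ideal I R \<longleftrightarrow>
    pure_ideal I R \<and> I \<noteq> carrier R \<and>
    (\<forall>J. pure_ideal J R \<longrightarrow> J \<noteq> carrier R \<longrightarrow> I \<subseteq> J \<longrightarrow> J = I)"

definition ring_idempotent :: "'a \<Rightarrow> ('a, 'b) ring_scheme \<Rightarrow> bool"
  where "ring_idempotent e R \<longleftrightarrow> e \<in> carrier R \<and> e \<otimes>\<^bsub>R\<^esub> e = e"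

definition primitive_idempotent :: "'a \<Rightarrow> ('a, 'b) ring_scheme \<Rightarrow> bool"
  where "primitive_idempotent e R \<longleftrightarrow>
    ring_idempotent e R \<and> e \<noteq> \<zero>\<^bsub>R\<^esub> \<and>
    (\<forall>e'. ring_idempotent e' R \<longrightarrow> e' \<noteq> \<zero>\<^bsub>R\<^esub> \<longrightarrow> e \<otimes>\<^bsub>R\<^esub> e' = e' \<longrightarrow> e = e')"

end

theory Submission
  imports Defs
begin

text \<open>
  A finitely generated pure ideal contains an element \<open>b\<close> acting as identity on the finitely many
  generators, hence on the whole ideal; so \<open>b\<close> is idempotent and generates the ideal. If an
  idempotent \<open>e\<close> had infinitely many idempotents below it, choose such an \<open>e\<close> with \<open>R(1-e)\<close> maximal:
  a splitting \<open>e = f + (e - f)\<close> writes each idempotent below \<open>e\<close> as a sum of one below \<open>f\<close> and one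
  below \<open>e - f\<close>, and there are only finitely many of both.
\<close>

text \<open>Zorn's lemma applies because a nonempty chain of ideals in a Noetherian ring contains
  its own union, which is therefore an upper bound inside \<open>S\<close>.\<close>

lemma (in noetherian_ring) exists_maximal_ideal:
  assumes "S \<noteq> {}" and "\<And>I. I \<in> S \<Longrightarrow> ideal I R"
  obtains M where "M \<in> S" and "\<And>I. I \<in> S \<Longrightarrow> M \<subseteq> I \<Longrightarrow> I = M"
proof -
  have "\<Union>C \<in> S" if "C \<noteq> {}" and C: "subset.chain S C" for C
  proof -
    have "subset.chain {I. ideal I R} C"
      using C assms(2) by (auto simp: subset.chain_def)
    then have "\<Union>C \<in> C" using ideal_chain_is_trivial that(1) by blast
    then show ?thesis using C by (auto simp: subset.chain_def)
  qed
  then show ?thesis using subset_Zorn_nonempty[OF assms(1)] that by blast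
qed

context cring
begin

section \<open>Arithmetic of idempotents and the ideals they generate\<close>

lemma minus_eq_zero_iff:
  assumes "x \<in> carrier R" and "y \<in> carrier R"
  shows "x \<ominus> y = \<zero> \<longleftrightarrow> x = y"
  using assms r_right_minus_eq by blast

lemma mult_one_minus_eq_zero_iff:
  assumes "x \<in> carrier R" and "y \<in> carrier R"
  shows "x \<otimes> (\<one> \<ominus> y) = \<zero> \<longleftrightarrow> x \<otimes> y = x"
proof -
  have "x \<otimes> (\<one> \<ominus> y) = x \<ominus> x \<otimes> y" using assms by algebra
  then show ?thesis using minus_eq_zero_iff[of x "x \<otimes> y"] assms by auto
qed

lemma mult_one_minus_eq_iff:
  assumes "x \<in> carrier R" and "y \<in> carrier R"
  shows "x \<otimes> (\<one> \<ominus> y) = x \<longleftrightarrow> x \<otimes> y = \<zero>"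
proof -
  have "x \<otimes> (\<one> \<ominus> y) \<ominus> x = \<ominus> (x \<otimes> y)" using assms by algebra
  then show ?thesis
    using minus_eq_zero_iff[of "x \<otimes> (\<one> \<ominus> y)" x] assms minus_closed one_closed
    by (metis m_closed minus_minus minus_zero)
qed

lemma ring_idempotentD:
  assumes "ring_idempotent e R"
  shows "e \<in> carrier R" and "e \<otimes> e = e"
  using assms by (auto simp: ring_idempotent_def)

lemma ring_idempotent_one_minus:
  assumes "ring_idempotent e R"
  shows "ring_idempotent (\<one> \<ominus> e) R"
proof -
  note e = ring_idempotentD[OF assms]
  have "(\<one> \<ominus> e) \<otimes> e = \<zero>"
    using e by (simp add: m_comm mult_one_minus_eq_zero_iff)
  then show ?thesis
    using e by (simp add: ring_idempotent_def mult_one_minus_eq_iff)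
qed

lemma ring_idempotent_mult:
  assumes "ring_idempotent e R" and "ring_idempotent f R"
  shows "ring_idempotent (e \<otimes> f) R"
proof -
  note e = ring_idempotentD[OF assms(1)] and f = ring_idempotentD[OF assms(2)]
  have "e \<otimes> f \<otimes> (e \<otimes> f) = (e \<otimes> e) \<otimes> (f \<otimes> f)" using e(1) f(1) by algebra
  then show ?thesis using e f by (simp add: ring_idempotent_def)
qed

text \<open>Every multiple of \<open>e\<close> is fixed by a further multiplication with
  \<open>e\<close>, so membership becomes an equation.\<close>

lemma mem_cgenideal_idempotent_iff:
  assumes "ring_idempotent e R"
  shows "x \<in> PIdl e \<longleftrightarrow> x \<in> carrier R \<and> x \<otimes> e = x"
  using ring_idempotentD[OF assms] unfolding cgenideal_def
  by (auto simp: m_assoc) metis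

text \<open>The previous criterion for the complementary idempotent: R(1-e) is the annihilator of
  \<open>e\<close>. Most later arguments about R(1-e) use this form.\<close>

lemma mem_cgenideal_one_minus_iff:
  assumes "ring_idempotent e R"
  shows "x \<in> PIdl (\<one> \<ominus> e) \<longleftrightarrow> x \<in> carrier R \<and> x \<otimes> e = \<zero>"
  using mem_cgenideal_idempotent_iff[OF ring_idempotent_one_minus[OF assms]]
    mult_one_minus_eq_iff ring_idempotentD(1)[OF assms] by blast

section \<open>Pure ideals and idempotent generators\<close>

lemma pure_cgenideal:
  assumes "ring_idempotent e R"
  shows "pure_ideal (PIdl e) R"
  unfolding pure_ideal_def
proof (intro conjI ballI bexI)
  note e = ring_idempotentD[OF assms]
  show "ideal (PIdl e) R" using cgenideal_ideal[OF e(1)] .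
  show "e \<in> PIdl e" using cgenideal_self[OF e(1)] .
  show "a \<otimes> (\<one> \<ominus> e) = \<zero>" if "a \<in> PIdl e" for a
    using that e(1) assms mem_cgenideal_idempotent_iff mult_one_minus_eq_zero_iff by blast
qed

text \<open>Purity gives a witness for each single element; induction on \<open>A\<close> merges the
  witnesses into one.\<close>

lemma pure_ideal_common_identity:
  assumes I: "pure_ideal I R" and "finite A" and "A \<subseteq> I"
  shows "\<exists>b\<in>I. \<forall>a\<in>A. a \<otimes> (\<one> \<ominus> b) = \<zero>"
  using assms(2,3)
proof (induction A rule: finite_induct)
  case empty
  interpret I: ideal I R using I by (simp add: pure_ideal_def)
  show ?case using I.zero_closed by blast
next
  case (insert a A)
  interpret I: ideal I R using I by (simp add: pure_ideal_def)
  obtain b where b: "b \<in> I" "\<forall>x\<in>A. x \<otimes> (\<one> \<ominus> b) = \<zero>" using insert by auto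
  obtain c where c: "c \<in> I" "a \<otimes> (\<one> \<ominus> c) = \<zero>"
    using I insert.prems by (auto simp: pure_ideal_def)
  \<comment> \<open>Chosen so that 1-d = (1-b)(1-c): the first factor kills \<open>A\<close>, the
    second kills \<open>a\<close>.\<close>
  define d where "d = b \<oplus> (\<one> \<ominus> b) \<otimes> c"
  have car: "b \<in> carrier R" "c \<in> carrier R" using b(1) c(1) I.Icarr by auto
  have one_minus_d: "\<one> \<ominus> d = (\<one> \<ominus> b) \<otimes> (\<one> \<ominus> c)"
    unfolding d_def using car by algebra
  have "d \<in> I" unfolding d_def
    using b(1) c(1) car by (simp add: I.a_closed I.I_l_closed)
  moreover have "x \<otimes> (\<one> \<ominus> d) = \<zero>" if "x \<in> insert a A" for x
  proof -
    have x: "x \<in> carrier R" using that insert.prems I.Icarr by auto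
    have 1: "x \<otimes> (\<one> \<ominus> d) = (x \<otimes> (\<one> \<ominus> b)) \<otimes> (\<one> \<ominus> c)"
      using x car by (simp add: one_minus_d m_assoc)
    have 2: "x \<otimes> (\<one> \<ominus> d) = (x \<otimes> (\<one> \<ominus> c)) \<otimes> (\<one> \<ominus> b)"
      using x car unfolding one_minus_d by algebra
    show ?thesis using that b(2) c(2) 1 2 car by auto
  qed
  ultimately show ?case by blast
qed

text \<open>With \<open>y\<close> = 1-b this lets a relation checked on generators spread to the
  ideal they generate.\<close>

lemma annihilator_ideal:
  assumes "y \<in> carrier R"
  shows "ideal {x \<in> carrier R. x \<otimes> y = \<zero>} R"
proof (rule idealI)
  show "subgroup {x \<in> carrier R. x \<otimes> y = \<zero>} (add_monoid R)"
    using assms by unfold_locales (auto simp: l_distr l_minus a_inv_def[symmetric])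
next
  fix a x assume a: "a \<in> {x \<in> carrier R. x \<otimes> y = \<zero>}" and x: "x \<in> carrier R"
  have "x \<otimes> a \<otimes> y = x \<otimes> (a \<otimes> y)" using a x assms by (simp add: m_assoc)
  then show "x \<otimes> a \<in> {x \<in> carrier R. x \<otimes> y = \<zero>}" using a x by simp
  then show "a \<otimes> x \<in> {x \<in> carrier R. x \<otimes> y = \<zero>}" using a x m_comm by simp
qed (rule ring_axioms)

lemma pure_genideal_idempotent:
  assumes "pure_ideal (Idl A) R" and "finite A" and "A \<subseteq> carrier R"
  shows "\<exists>e. ring_idempotent e R \<and> Idl A = PIdl e"
proof -
  interpret I: ideal "Idl A" R using assms(1) by (simp add: pure_ideal_def)
  obtain b where b: "b \<in> Idl A" "\<forall>a\<in>A. a \<otimes> (\<one> \<ominus> b) = \<zero>"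
    using pure_ideal_common_identity[OF assms(1,2)] genideal_self[OF assms(3)] by blast
  have car: "b \<in> carrier R" using b(1) I.Icarr by blast
  have "Idl A \<subseteq> {x \<in> carrier R. x \<otimes> (\<one> \<ominus> b) = \<zero>}"
    using b(2) assms(3) car by (intro genideal_minimal annihilator_ideal) auto
  then have ident: "x \<otimes> b = x" if "x \<in> Idl A" for x
    using that mult_one_minus_eq_zero_iff car by blast
  \<comment> \<open>The identity property is applied to \<open>b\<close> itself, which lies in the
    ideal.\<close>
  then have idem: "ring_idempotent b R" using b(1) car by (simp add: ring_idempotent_def)
  moreover have "Idl A = PIdl b"
    using ident I.Icarr cgenideal_minimal[OF I.ideal_axioms b(1)]
      mem_cgenideal_idempotent_iff[OF idem] by blast
  ultimately show ?thesis by blast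
qed

lemma noetherian_pure_ideal_iff:
  assumes "noetherian_ring R"
  shows "pure_ideal I R \<longleftrightarrow> (\<exists>e. ring_idempotent e R \<and> I = PIdl e)"
  using noetherian_ring.finetely_gen[OF assms, of I] pure_genideal_idempotent pure_cgenideal
  by (auto simp: pure_ideal_def)

section \<open>Finiteness of the set of idempotents\<close>

lemma ring_idempotent_minus:
  assumes "ring_idempotent e R" and "ring_idempotent f R" and "f \<otimes> e = f"
  shows "ring_idempotent (e \<ominus> f) R"
proof -
  note e = ring_idempotentD[OF assms(1)] and f = ring_idempotentD[OF assms(2)]
  have "e \<otimes> (\<one> \<ominus> f) = e \<ominus> f \<otimes> e" using e(1) f(1) by algebra
  then have "e \<ominus> f = e \<otimes> (\<one> \<ominus> f)" using assms(3) by simp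
  then show ?thesis using assms ring_idempotent_mult ring_idempotent_one_minus by simp
qed

text \<open>The inclusion puts 1-f into the annihilator of \<open>e\<close>, so e = ef, and ef = f
  by assumption. Together with the next lemma, going strictly down among idempotents means going
  strictly up among the ideals R(1-e).\<close>

lemma cgenideal_one_minus_eqD:
  assumes "ring_idempotent e R" and "ring_idempotent f R" and "f \<otimes> e = f"
    and "PIdl (\<one> \<ominus> f) \<subseteq> PIdl (\<one> \<ominus> e)"
  shows "f = e"
proof -
  note e = ring_idempotentD[OF assms(1)] and f = ring_idempotentD[OF assms(2)]
  have "\<one> \<ominus> f \<in> PIdl (\<one> \<ominus> e)" using assms(4) cgenideal_self[of "\<one> \<ominus> f"] f(1) by auto
  then have "e \<otimes> (\<one> \<ominus> f) = \<zero>"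
    using mem_cgenideal_one_minus_iff[OF assms(1)] e(1) m_comm by auto
  then show ?thesis
    using mult_one_minus_eq_zero_iff e(1) f(1) assms(3) m_comm by metis
qed

lemma cgenideal_one_minus_mono:
  assumes "ring_idempotent e R" and "ring_idempotent f R" and "f \<otimes> e = f"
  shows "PIdl (\<one> \<ominus> e) \<subseteq> PIdl (\<one> \<ominus> f)"
proof
  note e = ring_idempotentD[OF assms(1)] and f = ring_idempotentD[OF assms(2)]
  fix x assume "x \<in> PIdl (\<one> \<ominus> e)"
  then have x: "x \<in> carrier R" "x \<otimes> e = \<zero>"
    using mem_cgenideal_one_minus_iff[OF assms(1)] by auto
  have "x \<otimes> f = x \<otimes> (f \<otimes> e)" using assms(3) by simp
  also have "\<dots> = f \<otimes> (x \<otimes> e)" using x(1) e(1) f(1) by algebra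
  finally show "x \<in> PIdl (\<one> \<ominus> f)"
    using mem_cgenideal_one_minus_iff[OF assms(2)] x f(1) by simp
qed

lemma noetherian_finite_idempotents:
  assumes "noetherian_ring R"
  shows "finite {e. ring_idempotent e R}"
proof (rule ccontr)
  interpret N: noetherian_ring R by fact
  \<comment> \<open>\<open>D e\<close> collects the idempotents below \<open>e\<close>, and
    \<open>B\<close> the idempotents with infinitely many below them. If there are infinitely many
    idempotents in all, then 1 is in \<open>B\<close>.\<close>
  define D where "D e = {h. ring_idempotent h R \<and> h \<otimes> e = h}" for e
  define B where "B = {e. ring_idempotent e R \<and> infinite (D e)}"
  assume "infinite {e. ring_idempotent e R}"
  moreover have "D \<one> = {e. ring_idempotent e R}"
    by (auto simp: D_def dest: ring_idempotentD)
  ultimately have "\<one> \<in> B" by (simp add: B_def ring_idempotent_def)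
  then obtain M where M: "M \<in> (\<lambda>e. PIdl (\<one> \<ominus> e)) ` B"
    and max: "\<And>I. I \<in> (\<lambda>e. PIdl (\<one> \<ominus> e)) ` B \<Longrightarrow> M \<subseteq> I \<Longrightarrow> I = M"
    by (rule_tac N.exists_maximal_ideal[of "(\<lambda>e. PIdl (\<one> \<ominus> e)) ` B"])
      (auto simp: B_def intro!: cgenideal_ideal dest: ring_idempotentD)
  obtain e where e: "e \<in> B" and Me: "M = PIdl (\<one> \<ominus> e)" using M by blast
  have ide: "ring_idempotent e R" and inf: "infinite (D e)" using e by (auto simp: B_def)
  note ce = ring_idempotentD[OF ide]
  \<comment> \<open>Such an \<open>f\<close> in \<open>B\<close> would give an ideal R(1-f) strictly
    above the maximal one.\<close>
  have below: "finite (D f)" if "f \<in> D e" "f \<noteq> e" for f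
  proof (rule ccontr)
    assume "infinite (D f)"
    then have "f \<in> B" using that by (simp add: B_def D_def)
    with max[of "PIdl (\<one> \<ominus> f)"] that cgenideal_one_minus_mono[OF ide] show False
      using cgenideal_one_minus_eqD[OF ide] by (auto simp: D_def Me)
  qed
  \<comment> \<open>An infinite set has a member outside {e, 0}; this \<open>f\<close> splits
    \<open>e\<close> nontrivially.\<close>
  obtain f where f: "f \<in> D e" "f \<noteq> e" "f \<noteq> \<zero>"
    using infinite_super[of "D e" "{e, \<zero>}"] inf by blast
  have idf: "ring_idempotent f R" and fe: "f \<otimes> e = f" using f by (auto simp: D_def)
  note cf = ring_idempotentD[OF idf]
  define g where "g = e \<ominus> f"
  have idg: "ring_idempotent g R"
    unfolding g_def using ring_idempotent_minus[OF ide idf fe] .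
  note cg = ring_idempotentD[OF idg]
  have "g \<otimes> e = e \<otimes> e \<ominus> f \<otimes> e" unfolding g_def using ce(1) cf(1) by algebra
  then have "g \<in> D e" using idg ce fe by (simp add: D_def g_def)
  moreover have "g \<noteq> e"
  proof
    assume "g = e"
    moreover have "f = e \<ominus> g" unfolding g_def using ce(1) cf(1) by algebra
    ultimately show False using f(3) ce(1) minus_eq_zero_iff by auto
  qed
  ultimately have "finite (D f \<times> D g)" using below f by blast
  \<comment> \<open>Each \<open>h\<close> below \<open>e\<close> is h = he = hf + hg, so two finite
    sets of summands would exhaust the infinite \<open>D e\<close>.\<close>
  moreover have "D e \<subseteq> (\<lambda>(x, y). x \<oplus> y) ` (D f \<times> D g)"
  proof
    fix h assume "h \<in> D e"
    then have idh: "ring_idempotent h R" and he: "h \<otimes> e = h" by (auto simp: D_def)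
    note ch = ring_idempotentD[OF idh]
    have "h \<otimes> e = h \<otimes> f \<oplus> h \<otimes> g" unfolding g_def using ch(1) ce(1) cf(1) by algebra
    moreover have "h \<otimes> f \<in> D f" "h \<otimes> g \<in> D g"
      using ring_idempotent_mult[OF idh] idf idg ch cf cg by (auto simp: D_def m_assoc)
    ultimately show "h \<in> (\<lambda>(x, y). x \<oplus> y) ` (D f \<times> D g)" using he by force
  qed
  ultimately show False using inf finite_surj by blast
qed

section \<open>Primitive idempotents and purely-prime ideals\<close>

text \<open>The product is an idempotent below \<open>e\<close>, so primitivity leaves only the two
  extremes.\<close>

lemma primitive_idempotent_mult_cases:
  assumes "primitive_idempotent e R" and "ring_idempotent a R"
  shows "a \<otimes> e = \<zero> \<or> a \<otimes> e = e"
proof -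
  have ide: "ring_idempotent e R" using assms(1) by (simp add: primitive_idempotent_def)
  note e = ring_idempotentD[OF ide] and a = ring_idempotentD[OF assms(2)]
  have "e \<otimes> (a \<otimes> e) = a \<otimes> (e \<otimes> e)" using e(1) a(1) by algebra
  then have "e \<otimes> (a \<otimes> e) = a \<otimes> e" using e(2) by simp
  then show ?thesis
    using assms(1) ring_idempotent_mult[OF assms(2) ide]
    unfolding primitive_idempotent_def by metis
qed

lemma cgenideal_one_minus_proper:
  assumes "ring_idempotent e R" and "e \<noteq> \<zero>"
  shows "PIdl (\<one> \<ominus> e) \<noteq> carrier R"
  using mem_cgenideal_one_minus_iff[OF assms(1), of \<one>] assms(2) ring_idempotentD(1)[OF assms(1)]
  by auto

lemma noetherian_purely_primeI:
  assumes "noetherian_ring R" and e: "primitive_idempotent e R"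
  shows "purely_prime_ideal (PIdl (\<one> \<ominus> e)) R"
  unfolding purely_prime_ideal_def
proof (intro conjI allI impI)
  have ide: "ring_idempotent e R" and nz: "e \<noteq> \<zero>"
    using e by (simp_all add: primitive_idempotent_def)
  note ce = ring_idempotentD(1)[OF ide]
  show "pure_ideal (PIdl (\<one> \<ominus> e)) R"
    using pure_cgenideal ring_idempotent_one_minus[OF ide] .
  show "PIdl (\<one> \<ominus> e) \<noteq> carrier R" using cgenideal_one_minus_proper[OF ide nz] .
  fix J J' assume J: "pure_ideal J R" "pure_ideal J' R" "J \<cdot> J' \<subseteq> PIdl (\<one> \<ominus> e)"
  obtain a b where ab: "ring_idempotent a R" "J = PIdl a" "ring_idempotent b R" "J' = PIdl b"
    using J(1,2) noetherian_pure_ideal_iff[OF assms(1)] by metis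
  note ca = ring_idempotentD(1)[OF ab(1)] and cb = ring_idempotentD(1)[OF ab(3)]
  have "a \<otimes> b \<in> J \<cdot> J'"
    using ab ca cb by (simp add: ideal_prod.prod cgenideal_self)
  then have "a \<otimes> (b \<otimes> e) = \<zero>"
    using J(3) mem_cgenideal_one_minus_iff[OF ide] ca cb ce m_assoc by auto
  \<comment> \<open>If be is not zero it equals \<open>e\<close>, and then abe = 0 reads ae =
    0.\<close>
  then have "a \<otimes> e = \<zero> \<or> b \<otimes> e = \<zero>"
    using primitive_idempotent_mult_cases[OF e ab(1)] primitive_idempotent_mult_cases[OF e ab(3)]
    by auto
  then have "a \<in> PIdl (\<one> \<ominus> e) \<or> b \<in> PIdl (\<one> \<ominus> e)"
    using mem_cgenideal_one_minus_iff[OF ide] ca cb by simp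
  then show "J \<subseteq> PIdl (\<one> \<ominus> e) \<or> J' \<subseteq> PIdl (\<one> \<ominus> e)"
    using ab cgenideal_minimal[OF cgenideal_ideal] ce by blast
qed

text \<open>A pure ideal Ra above R(1-e) has ae = e or ae = 0. The first puts both \<open>e\<close>
  and 1-e into the ideal, making it all of \<open>R\<close>; the second puts \<open>a\<close> into
  R(1-e).\<close>

lemma noetherian_purely_maximalI:
  assumes "noetherian_ring R" and e: "primitive_idempotent e R"
  shows "purely_maximal_ideal (PIdl (\<one> \<ominus> e)) R"
  unfolding purely_maximal_ideal_def
proof (intro conjI allI impI)
  have ide: "ring_idempotent e R" and nz: "e \<noteq> \<zero>"
    using e by (simp_all add: primitive_idempotent_def)
  note ce = ring_idempotentD(1)[OF ide]
  show "pure_ideal (PIdl (\<one> \<ominus> e)) R"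
    using pure_cgenideal ring_idempotent_one_minus[OF ide] .
  show "PIdl (\<one> \<ominus> e) \<noteq> carrier R" using cgenideal_one_minus_proper[OF ide nz] .
  fix J assume J: "pure_ideal J R" "J \<noteq> carrier R" "PIdl (\<one> \<ominus> e) \<subseteq> J"
  obtain a where a: "ring_idempotent a R" "J = PIdl a"
    using J(1) noetherian_pure_ideal_iff[OF assms(1)] by blast
  note ca = ring_idempotentD(1)[OF a(1)]
  interpret J: ideal J R using J(1) by (simp add: pure_ideal_def)
  have "a \<otimes> e \<noteq> e"
  proof
    assume "a \<otimes> e = e"
    then have "e \<in> J" using mem_cgenideal_idempotent_iff[OF a(1)] a(2) m_comm[OF ca ce] ce by simp
    moreover have "\<one> \<ominus> e \<in> J" using J(3) cgenideal_self[of "\<one> \<ominus> e"] ce by auto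
    ultimately have "\<one> \<ominus> e \<oplus> e \<in> J" by blast
    moreover have "\<one> \<ominus> e \<oplus> e = \<one>" using ce by algebra
    ultimately show False using J(2) J.one_imp_carrier by simp
  qed
  then have "a \<otimes> e = \<zero>" using primitive_idempotent_mult_cases[OF e a(1)] by blast
  then have "a \<in> PIdl (\<one> \<ominus> e)" using mem_cgenideal_one_minus_iff[OF ide] ca by simp
  then show "J = PIdl (\<one> \<ominus> e)"
    using J(3) a(2) cgenideal_minimal[OF cgenideal_ideal] ce by blast
qed

text \<open>Write P = Rf and take e = 1-f. For a nonzero idempotent \<open>h\<close> below
  \<open>e\<close>, primeness is tested on the complementary pair Rh and R(1-h).\<close>

lemma noetherian_purely_prime_primitive:
  assumes "noetherian_ring R" and P: "purely_prime_ideal P R"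
  shows "\<exists>e. primitive_idempotent e R \<and> P = PIdl (\<one> \<ominus> e)"
proof -
  obtain f where idf: "ring_idempotent f R" and Pf: "P = PIdl f"
    using P noetherian_pure_ideal_iff[OF assms(1)] by (auto simp: purely_prime_ideal_def)
  note cf = ring_idempotentD(1)[OF idf]
  define e where "e = \<one> \<ominus> f"
  have ide: "ring_idempotent e R"
    unfolding e_def using ring_idempotent_one_minus[OF idf] .
  note ce = ring_idempotentD(1)[OF ide]
  have "\<one> \<ominus> e = f" unfolding e_def using cf by algebra
  then have Pe: "P = PIdl (\<one> \<ominus> e)" using Pf by simp
  have mem: "x \<in> P \<longleftrightarrow> x \<in> carrier R \<and> x \<otimes> e = \<zero>" for x
    unfolding Pe using mem_cgenideal_one_minus_iff[OF ide] .
  have "e \<noteq> \<zero>"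
  proof
    assume "e = \<zero>"
    then have "x \<in> P \<longleftrightarrow> x \<in> carrier R" for x using mem[of x] r_null[of x] by metis
    then have "P = carrier R" by blast
    then show False using P by (simp add: purely_prime_ideal_def)
  qed
  moreover have "e = h" if h: "ring_idempotent h R" "h \<noteq> \<zero>" "e \<otimes> h = h" for h
  proof -
    note ch = ring_idempotentD(1)[OF h(1)]
    have id': "ring_idempotent (\<one> \<ominus> h) R" using ring_idempotent_one_minus[OF h(1)] .
    have "(PIdl h) \<cdot> (PIdl (\<one> \<ominus> h)) \<subseteq> PIdl h \<inter> PIdl (\<one> \<ominus> h)"
      using ch by (intro ideal_prod_inter cgenideal_ideal) auto
    \<comment> \<open>A common element \<open>x\<close> satisfies x = xh = 0.\<close>
    also have "\<dots> \<subseteq> P"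
      using mem_cgenideal_one_minus_iff[OF h(1)] mem_cgenideal_idempotent_iff[OF h(1)]
        mem ce by auto
    finally have "PIdl h \<subseteq> P \<or> PIdl (\<one> \<ominus> h) \<subseteq> P"
      using P pure_cgenideal[OF h(1)] pure_cgenideal[OF id'] by (simp add: purely_prime_ideal_def)
    then have "h \<in> P \<or> \<one> \<ominus> h \<in> P"
      using cgenideal_self[of h] cgenideal_self[of "\<one> \<ominus> h"] ch by auto
    \<comment> \<open>\<open>P\<close> is the annihilator of \<open>e\<close>, whereas he = h is
      nonzero.\<close>
    moreover have "h \<notin> P" using mem h m_comm[OF ch ce] by simp
    ultimately have "e \<otimes> (\<one> \<ominus> h) = \<zero>"
      using mem ce m_comm by auto
    then show ?thesis using mult_one_minus_eq_zero_iff ch ce h(3) by simp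
  qed
  ultimately have "primitive_idempotent e R"
    using ide by (auto simp: primitive_idempotent_def)
  with Pe show ?thesis by blast
qed

end

theorem corollary2p4:
  fixes R :: "('a, 'b) ring_scheme" (structure)
  assumes "cring R" and "noetherian_ring R"
  shows "(finite {I. pure_ideal I R} \<and>
          {I. pure_ideal I R} = {PIdl e | e. ring_idempotent e R} \<and>
          (\<forall>P. purely_prime_ideal P R \<longrightarrow> purely_maximal_ideal P R)) \<and>
         {P. purely_prime_ideal P R} = {PIdl (\<one> \<ominus> e) | e. primitive_idempotent e R}"
proof -
  interpret cring R by fact
  note noeth = assms(2)
  have pure: "{I. pure_ideal I R} = {PIdl e | e. ring_idempotent e R}"
    using noetherian_pure_ideal_iff[OF noeth] by blast
  moreover have "finite {I. pure_ideal I R}"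
    unfolding pure using noetherian_finite_idempotents[OF noeth] by simp
  \<comment> \<open>A purely-prime ideal is R(1-e) for some primitive \<open>e\<close>, and every
    ideal of that form is purely-maximal.\<close>
  moreover have "\<forall>P. purely_prime_ideal P R \<longrightarrow> purely_maximal_ideal P R"
    using noetherian_purely_prime_primitive[OF noeth] noetherian_purely_maximalI[OF noeth] by blast
  moreover have "{P. purely_prime_ideal P R} = {PIdl (\<one> \<ominus> e) | e. primitive_idempotent e R}"
    using noetherian_purely_prime_primitive[OF noeth] noetherian_purely_primeI[OF noeth] by blast
  ultimately show ?thesis by blast
qed

end
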